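(* Let $\mathcal{H}$ be a real Hilbert space, $J\in\mathcal{C}$ and $K:=\partial J(0)$. An element $p\in K$ is an eigenvector of $\partial J$ with eigenvalue $1$ if and only if $$\langle p,p-q\rangle\ge 0\qquad\forall q\in K.$$
   Context: The class $\mathcal{C}$ consists of all maps $J:\mathcal{H}\to\mathbb{R}\cup\{+\infty\}$ that are convex, lower semicontinuous with respect to the strong topology of $\mathcal{H}$, and absolutely one-homogeneous, i.e. $J(cu)=|c|J(u)$ for all $u\in\mathcal{H}$, $c\in\mathbb{R}\setminus\{0\}$, and $J(0)=0$. The subdifferential is $\partial J(u)=\{p\in\mathcal{H}:\langle p,v\rangle\le J(v)\ \forall v\in\mathcal{H},\ \langle p,u\rangle=J(u)\}$; in particular $\partial J(0)=\{p\in\mathcal{H}:\langle p,v\rangle\le J(v)\ \forall v\in\mathcal{H}\}$. A vector $u$ is an eigenvector of $\partial J$ with eigenvalue $\lambda\in\mathbb{R}$ if $\lambda u\in\partial J(u)$. *)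

theory Defs
  imports "HOL-Analysis.Analysis"
begin

text \<open>
  A real Hilbert space is a type of sort \<open>{real_inner, complete_space}\<close>. Functionals with values
  in the reals extended by plus infinity are \<open>ereal\<close>-valued maps that never take the value \<open>-\<infinity>\<close>.
\<close>

text \<open>The convention \<open>0 * \<infinity> = 0\<close> on \<open>ereal\<close> makes the endpoint cases of the inequality trivial.\<close>

definition convex_functional :: "('a::real_vector \<Rightarrow> ereal) \<Rightarrow> bool" where
  "convex_functional J \<longleftrightarrow>
     (\<forall>u v. \<forall>t\<in>{0..1}. J ((1 - t) *\<^sub>R u + t *\<^sub>R v) \<le> ereal (1 - t) * J u + ereal t * J v)"

definition lower_semicontinuous :: "('a::topological_space \<Rightarrow> ereal) \<Rightarrow> bool" where
  "lower_semicontinuous J \<longleftrightarrow> (\<forall>u. J u \<le> Liminf (at u) J)"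

definition abs_one_homogeneous :: "('a::real_vector \<Rightarrow> ereal) \<Rightarrow> bool" where
  "abs_one_homogeneous J \<longleftrightarrow>
     (\<forall>u. \<forall>c::real. c \<noteq> 0 \<longrightarrow> J (c *\<^sub>R u) = ereal \<bar>c\<bar> * J u) \<and> J 0 = 0"

text \<open>The topology of the type class is the norm topology, so lower semicontinuity is the strong one.\<close>

definition class_C :: "('a::{real_inner, complete_space} \<Rightarrow> ereal) set" where
  "class_C = {J. (\<forall>u. J u \<noteq> -\<infinity>) \<and> convex_functional J \<and> lower_semicontinuous J
                 \<and> abs_one_homogeneous J}"

text \<open>
  This is the form the convex subdifferential takes for absolutely one-homogeneous functionals.
\<close>

definition subdifferential :: "('a::real_inner \<Rightarrow> ereal) \<Rightarrow> 'a \<Rightarrow> 'a set" where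
  "subdifferential J u = {p. (\<forall>v. ereal (p \<bullet> v) \<le> J v) \<and> ereal (p \<bullet> u) = J u}"

text \<open>The zero vector is not excluded; it is an eigenvector for every eigenvalue whenever \<open>J \<in> class_C\<close>.\<close>

definition is_eigenvector :: "('a::real_inner \<Rightarrow> ereal) \<Rightarrow> 'a \<Rightarrow> real \<Rightarrow> bool" where
  "is_eigenvector J u l \<longleftrightarrow> l *\<^sub>R u \<in> subdifferential J u"

end

theory Submission
  imports Defs
begin

text \<open>
  If \<open>p\<close> is an eigenvector with eigenvalue 1, then \<open>J p = p \<bullet> p\<close>, and every \<open>q \<in> K\<close> satisfies
  \<open>q \<bullet> p \<le> J p\<close>; this is the stated inequality.

  For the converse, the inequality says that \<open>p\<close> is the projection of \<open>2 p\<close> onto \<open>K\<close>.  By Moreau's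
  decomposition the residual \<open>2 p - p = p\<close> should then be the proximal point of \<open>2 p\<close>, whose
  optimality condition is \<open>p \<in> \<partial>J(p)\<close>.  The proof runs this argument from the proximal side:
  \<open>J v + (norm (v - 2 p))\<^sup>2 / 2\<close> has a minimiser \<open>u\<close> (lemma \<open>proximal_point_exists\<close>), and
  \<open>q = 2 p - u\<close> lies in \<open>\<partial>J(u)\<close> (lemma \<open>moreau_decomposition\<close>), hence in \<open>K\<close>.
  The assumption on \<open>p\<close> tested with \<open>q\<close> gives \<open>p \<bullet> (u - p) \<ge> 0\<close>, while \<open>p \<in> K\<close> gives
  \<open>p \<bullet> u \<le> J u = (2 p - u) \<bullet> u\<close>.  Adding these yields \<open>(norm (u - p))\<^sup>2 \<le> 0\<close>, so \<open>u = p = q\<close>.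
  In this way no separation theorem is involved; the Hilbert space structure enters through
  the completeness argument for the minimiser.
\<close>

lemma lower_semicontinuous_le_limit:
  fixes J :: "'a::topological_space \<Rightarrow> ereal" and b :: "nat \<Rightarrow> real"
  assumes lsc: "lower_semicontinuous J"
    and x: "x \<longlonglongrightarrow> u" and b: "b \<longlonglongrightarrow> r"
    and le: "\<And>n. J (x n) \<le> ereal (b n)"
  shows "J u \<le> ereal r"
proof (rule ccontr)
  assume "\<not> J u \<le> ereal r"
  then obtain c where c: "ereal r < c" "c < J u"
    using dense[of "ereal r" "J u"] by (auto simp: not_le)
  have "c < Liminf (at u) J"
    using lsc c(2) less_le_trans unfolding lower_semicontinuous_def by blast
  then have "eventually (\<lambda>y. c < J y) (at u)"
    by (rule less_LiminfD)
  then have "eventually (\<lambda>y. c < J y) (nhds u)"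
    using c(2) by (auto simp: eventually_at_filter elim: eventually_mono)
  then have 1: "eventually (\<lambda>n. c < J (x n)) sequentially"
    using x by (auto simp: filterlim_iff)
  have "(\<lambda>n. ereal (b n)) \<longlonglongrightarrow> ereal r"
    using b by simp
  then have "eventually (\<lambda>n. ereal (b n) < c) sequentially"
    using c(1) by (rule order_tendstoD)
  with 1 have "eventually (\<lambda>n. False) sequentially"
    by eventually_elim (use le in \<open>meson less_asym less_le_trans not_le order_trans\<close>)
  then show False by simp
qed

text \<open>
  Upper bounds by real numbers describe the epigraph of \<open>J\<close>; on it, convexity becomes an
  inequality between reals and the value \<open>\<infinity>\<close> needs no case distinctions.
\<close>

lemma convex_functional_epigraph:
  assumes "convex_functional J" "J u \<le> ereal r" "J v \<le> ereal s" "0 \<le> t" "t \<le> 1"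
  shows "J ((1 - t) *\<^sub>R u + t *\<^sub>R v) \<le> ereal ((1 - t) * r + t * s)"
proof -
  have "J ((1 - t) *\<^sub>R u + t *\<^sub>R v) \<le> ereal (1 - t) * J u + ereal t * J v"
    using assms unfolding convex_functional_def by auto
  also have "\<dots> \<le> ereal (1 - t) * ereal r + ereal t * ereal s"
    using assms by (intro add_mono ereal_mult_left_mono) auto
  finally show ?thesis by simp
qed

text \<open>
  By the parallelogram law the quadratic term is uniformly convex: the midpoint of two points
  improves on the mean of their values by \<open>(norm (v - w))\<^sup>2 / 8\<close>.  Minimising sequences are
  therefore Cauchy, and lower semicontinuity passes to their limit.
\<close>

lemma proximal_point_exists:
  fixes J :: "'a::{real_inner, complete_space} \<Rightarrow> ereal"
  assumes conv: "convex_functional J" and lsc: "lower_semicontinuous J"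
    and nonneg: "\<And>v. 0 \<le> J v" and proper: "J z \<noteq> \<infinity>"
  obtains u r where "J u = ereal r"
    "\<And>v s. J v \<le> ereal s \<Longrightarrow> r + (norm (u - f))\<^sup>2 / 2 \<le> s + (norm (v - f))\<^sup>2 / 2"
proof -
  define F where "F v s = s + (norm (v - f))\<^sup>2 / 2" for v s
  define S where "S = {F v s | v s. J v \<le> ereal s}"
  define m where "m = Inf S"
  have "J z \<le> ereal (real_of_ereal (J z))"
    using proper nonneg[of z] by (cases "J z") auto
  then have ne: "S \<noteq> {}" unfolding S_def by blast
  have "0 \<le> F v s" if "J v \<le> ereal s" for v s
  proof -
    have "0 \<le> ereal s" using nonneg[of v] that by (rule order_trans)
    then show ?thesis unfolding F_def by simp
  qed
  then have bdd: "bdd_below S"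
    unfolding S_def by (intro bdd_belowI[of _ 0]) auto
  have lower: "m \<le> F v s" if "J v \<le> ereal s" for v s
    unfolding m_def using that by (intro cInf_lower bdd) (auto simp: S_def)
  have "\<exists>v s. J v \<le> ereal s \<and> F v s < m + 1 / real (Suc n)" for n
  proof -
    have "\<exists>a\<in>S. a < m + 1 / real (Suc n)"
      unfolding m_def by (rule cInf_lessD[OF ne]) simp
    then show ?thesis by (auto simp: S_def)
  qed
  then obtain v s where vs: "\<And>n. J (v n) \<le> ereal (s n)"
    "\<And>n. F (v n) (s n) < m + 1 / real (Suc n)"
    by metis
  have gap: "(norm (v i - v j))\<^sup>2 / 8 \<le> (F (v i) (s i) + F (v j) (s j)) / 2 - m" for i j
  proof -
    let ?w = "(1 - 1/2) *\<^sub>R v i + (1/2) *\<^sub>R v j"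
    have "m \<le> F ?w ((1 - 1/2) * s i + 1/2 * s j)"
      by (intro lower convex_functional_epigraph conv vs(1)) auto
    moreover have "(norm (?w - f))\<^sup>2
        = ((norm (v i - f))\<^sup>2 + (norm (v j - f))\<^sup>2) / 2 - (norm (v i - v j))\<^sup>2 / 4"
      by (simp add: power2_norm_eq_inner inner_simps inner_commute field_simps)
    ultimately show ?thesis unfolding F_def by (simp add: field_simps)
  qed
  have "Cauchy v"
  proof (rule metric_CauchyI)
    fix e :: real assume "0 < e"
    then obtain M where M: "8 / e\<^sup>2 < real M"
      using reals_Archimedean2 by blast
    have small: "1 / real (Suc n) < e\<^sup>2 / 8" if "M \<le> n" for n
    proof -
      have "8 / e\<^sup>2 < real (Suc n)" using M that by linarith
      then show ?thesis using \<open>0 < e\<close> by (simp add: field_simps)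
    qed
    have "dist (v i) (v j) < e" if "M \<le> i" "M \<le> j" for i j
    proof -
      have "(norm (v i - v j))\<^sup>2 < e\<^sup>2"
        using gap[of i j] vs(2)[of i] vs(2)[of j] small[OF that(1)] small[OF that(2)]
        by argo
      then show ?thesis
        using \<open>0 < e\<close> by (simp add: dist_norm power2_less_imp_less)
    qed
    then show "\<exists>M. \<forall>i\<ge>M. \<forall>j\<ge>M. dist (v i) (v j) < e" by blast
  qed
  then obtain u where u: "v \<longlonglongrightarrow> u"
    using Cauchy_convergent_iff convergent_def by blast
  have "(\<lambda>n. m + 1 / real (Suc n)) \<longlonglongrightarrow> m + 0"
    using LIMSEQ_inverse_real_of_nat
    by (intro tendsto_add tendsto_const) (simp add: inverse_eq_divide)
  then have Fm: "(\<lambda>n. m + 1 / real (Suc n)) \<longlonglongrightarrow> m" by simp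
  have "(\<lambda>n. F (v n) (s n)) \<longlonglongrightarrow> m"
    by (rule tendsto_sandwich[OF _ _ tendsto_const Fm])
      (use vs lower in \<open>auto intro!: always_eventually less_imp_le\<close>)
  then have "(\<lambda>n. F (v n) (s n) - (norm (v n - f))\<^sup>2 / 2) \<longlonglongrightarrow> m - (norm (u - f))\<^sup>2 / 2"
    by (intro tendsto_intros u) auto
  then have "s \<longlonglongrightarrow> m - (norm (u - f))\<^sup>2 / 2"
    by (simp add: F_def)
  then have Ju: "J u \<le> ereal (m - (norm (u - f))\<^sup>2 / 2)"
    using lower_semicontinuous_le_limit[OF lsc u _ vs(1)] by blast
  then obtain r where r: "J u = ereal r"
    using nonneg[of u] by (cases "J u") auto
  with Ju have "F u r \<le> m" by (simp add: F_def)
  with lower r show ?thesis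
    by (intro that[of u r]) (auto simp: F_def intro: order_trans)
qed

text \<open>
  The optimality condition of the proximal problem: moving from \<open>u\<close> by \<open>t\<close> towards \<open>v\<close>
  changes the quadratic term by \<open>- t * ((f - u) \<bullet> (v - u))\<close> up to an error of order \<open>t\<^sup>2\<close>, so
  minimality makes \<open>f - u\<close> a subgradient.
\<close>

lemma proximal_point_subgradient:
  fixes J :: "'a::real_inner \<Rightarrow> ereal"
  assumes conv: "convex_functional J" and Ju: "J u = ereal r"
    and min: "\<And>v s. J v \<le> ereal s \<Longrightarrow> r + (norm (u - f))\<^sup>2 / 2 \<le> s + (norm (v - f))\<^sup>2 / 2"
    and Jv: "J v \<le> ereal s"
  shows "(f - u) \<bullet> (v - u) \<le> s - r"
proof -
  let ?A = "s - r - (f - u) \<bullet> (v - u)" and ?B = "(norm (v - u))\<^sup>2 / 2"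
  have step: "0 \<le> ?A + t * ?B" if t: "0 < t" "t \<le> 1" for t
  proof -
    let ?w = "(1 - t) *\<^sub>R u + t *\<^sub>R v"
    have w: "?w - f = t *\<^sub>R (v - u) - (f - u)"
      by (simp add: algebra_simps)
    have square: "(norm (t *\<^sub>R a - b))\<^sup>2 = (norm b)\<^sup>2 - 2 * t * (b \<bullet> a) + t\<^sup>2 * (norm a)\<^sup>2" for a b :: 'a
      unfolding power2_norm_eq_inner power2_eq_square[of t]
      by (simp add: inner_diff_left inner_diff_right inner_commute)
    have "(norm (?w - f))\<^sup>2
        = (norm (u - f))\<^sup>2 - 2 * t * ((f - u) \<bullet> (v - u)) + t\<^sup>2 * (norm (v - u))\<^sup>2"
      unfolding w norm_minus_commute[of u f] by (rule square)
    moreover have "r + (norm (u - f))\<^sup>2 / 2 \<le> (1 - t) * r + t * s + (norm (?w - f))\<^sup>2 / 2"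
      by (intro min convex_functional_epigraph conv Jv) (use Ju t in auto)
    ultimately have "0 \<le> t * (?A + t * ?B)"
      by (simp add: field_simps power2_eq_square)
    then show ?thesis using t(1) by (simp add: zero_le_mult_iff)
  qed
  have "(\<lambda>n. ?A + inverse (real (Suc n)) * ?B) \<longlonglongrightarrow> ?A + 0 * ?B"
    by (intro tendsto_intros LIMSEQ_inverse_real_of_nat)
  moreover have "0 \<le> ?A + inverse (real (Suc n)) * ?B" for n
    by (rule step) (auto simp: field_simps)
  ultimately have "0 \<le> ?A + 0 * ?B"
    by (blast intro: LIMSEQ_le_const)
  then show ?thesis by simp
qed

text \<open>Evenness puts 0 at the midpoint of two points of equal value.\<close>

lemma class_C_nonneg:
  assumes "J \<in> class_C"
  shows "0 \<le> J v"
proof (cases "J v")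
  case (real r)
  have "J (- v) = J v"
    using assms unfolding class_C_def abs_one_homogeneous_def
    by (auto dest!: spec[of _ v] spec[of _ "-1"] simp: one_ereal_def[symmetric])
  moreover have "convex_functional J"
    using assms by (simp add: class_C_def)
  ultimately have "J ((1 - 1/2) *\<^sub>R v + (1/2) *\<^sub>R (- v)) \<le> ereal ((1 - 1/2) * r + 1/2 * r)"
    using real by (intro convex_functional_epigraph) auto
  moreover have "J 0 = 0"
    using assms by (simp add: class_C_def abs_one_homogeneous_def)
  ultimately show ?thesis using real by simp
qed (use assms in \<open>auto simp: class_C_def\<close>)

text \<open>
  Among the subgradient inequalities at a proximal point \<open>u\<close>, those in the directions
  \<open>2 u\<close> and \<open>u / 2\<close> pin down \<open>(f - u) \<bullet> u = J u\<close>; this turns a subgradient in the sense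
  of convex analysis into an element of the one-homogeneous subdifferential.
\<close>

lemma moreau_decomposition:
  fixes J :: "'a::{real_inner, complete_space} \<Rightarrow> ereal"
  assumes J: "J \<in> class_C"
  obtains u where "f - u \<in> subdifferential J u"
proof -
  have conv: "convex_functional J" and lsc: "lower_semicontinuous J" and J0: "J 0 = 0"
    and hom: "\<And>c u. c \<noteq> 0 \<Longrightarrow> J (c *\<^sub>R u) = ereal \<bar>c\<bar> * J u"
    using J by (auto simp: class_C_def abs_one_homogeneous_def)
  obtain u r where Ju: "J u = ereal r"
    and min: "\<And>v s. J v \<le> ereal s \<Longrightarrow> r + (norm (u - f))\<^sup>2 / 2 \<le> s + (norm (v - f))\<^sup>2 / 2"
    using proximal_point_exists[OF conv lsc class_C_nonneg[OF J], of 0] J0 by auto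
  note sub = proximal_point_subgradient[OF conv Ju min]
  have "(f - u) \<bullet> (2 *\<^sub>R u - u) \<le> 2 * r - r"
    by (rule sub) (use hom[of 2 u] Ju in auto)
  then have upper: "(f - u) \<bullet> u \<le> r" by (simp add: scaleR_2)
  have "(f - u) \<bullet> ((1/2) *\<^sub>R u - u) \<le> (1/2) * r - r"
    by (rule sub) (use hom[of "1/2" u] Ju in auto)
  then have "r \<le> (f - u) \<bullet> u" by (simp add: inner_diff_right)
  with upper have eq: "(f - u) \<bullet> u = r" by simp
  have "ereal ((f - u) \<bullet> v) \<le> J v" for v
  proof (cases "J v")
    case (real s)
    with sub[of v s] eq show ?thesis by (simp add: inner_diff_right)
  qed (use class_C_nonneg[OF J, of v] in auto)
  with eq Ju show ?thesis
    by (intro that[of u]) (auto simp: subdifferential_def)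
qed

theorem proposition3p2:
  fixes J :: "'a::{real_inner, complete_space} \<Rightarrow> ereal"
    and K :: "'a set"
    and p :: 'a
  assumes "J \<in> class_C"
    and "K = subdifferential J 0"
    and "p \<in> K"
  shows "is_eigenvector J p 1 \<longleftrightarrow> (\<forall>q\<in>K. p \<bullet> (p - q) \<ge> 0)"
proof
  assume "is_eigenvector J p 1"
  then have Jp: "J p = ereal (p \<bullet> p)"
    by (simp add: is_eigenvector_def subdifferential_def)
  show "\<forall>q\<in>K. p \<bullet> (p - q) \<ge> 0"
  proof
    fix q assume "q \<in> K"
    then have "ereal (q \<bullet> p) \<le> J p"
      using assms(2) by (simp add: subdifferential_def)
    with Jp show "p \<bullet> (p - q) \<ge> 0"
      by (simp add: inner_diff_right inner_commute)
  qed
next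
  assume proj: "\<forall>q\<in>K. p \<bullet> (p - q) \<ge> 0"
  obtain u where u: "2 *\<^sub>R p - u \<in> subdifferential J u"
    using moreau_decomposition[OF assms(1)] .
  have "J 0 = 0"
    using assms(1) by (simp add: class_C_def abs_one_homogeneous_def)
  with u have "2 *\<^sub>R p - u \<in> K"
    using assms(2) by (simp add: subdifferential_def zero_ereal_def)
  with proj have 1: "p \<bullet> (p - (2 *\<^sub>R p - u)) \<ge> 0" by blast
  have "ereal (p \<bullet> u) \<le> J u"
    using assms(2,3) by (simp add: subdifferential_def)
  also have "J u = ereal ((2 *\<^sub>R p - u) \<bullet> u)"
    using u by (simp add: subdifferential_def)
  finally have "p \<bullet> u \<le> (2 *\<^sub>R p - u) \<bullet> u" by simp
  with 1 have "(u - p) \<bullet> (u - p) \<le> 0"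
    by (simp add: inner_simps inner_commute)
  then have "u = p"
    by (metis inner_gt_zero_iff not_less eq_iff_diff_eq_0)
  with u show "is_eigenvector J p 1"
    by (simp add: is_eigenvector_def scaleR_2)
qed

end
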